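(* Let $X$ be a strongly cellular-Lindelöf Hausdorff space with a dense set of isolated points. Then $|X| \leq 2^{\psi_c(X) \cdot t(X)}$.
   Context: A space is Lindelöf if every open cover has a countable subcover. A space $X$ is strongly cellular-Lindelöf if for every family $\mathcal{U}$ of pairwise disjoint non-empty open subsets of $X$ there is a closed Lindelöf subspace $Y \subset X$ such that $U \cap Y \neq \emptyset$ for every $U \in \mathcal{U}$. Cardinal functions take infinite values, as is usual. For a Hausdorff space $X$, the closed pseudocharacter $\psi_c(X)$ is the least infinite cardinal $\kappa$ such that for every $x \in X$ there is a family $\mathcal{U}_x$ of open neighbourhoods of $x$ with $|\mathcal{U}_x| \leq \kappa$ and $\bigcap \{\overline{U} : U \in \mathcal{U}_x\} = \{x\}$. $t(X)$ is the tightness of $X$: the least infinite cardinal $\kappa$ such that whenever $A \subset X$ and $x \in \overline{A}$ there is $B \subset A$ with $|B| \leq \kappa$ and $x \in \overline{B}$. *)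

theory Defs
  imports "HOL-Analysis.Lindelof_Spaces"
begin

unbundle cardinal_syntax

definition strongly_cellular_Lindelof_space :: "'a topology \<Rightarrow> bool" where
  "strongly_cellular_Lindelof_space X \<longleftrightarrow>
     (\<forall>\<U>. (\<forall>U\<in>\<U>. openin X U \<and> U \<noteq> {}) \<and> pairwise disjnt \<U> \<longrightarrow>
          (\<exists>Y. closedin X Y \<and> Lindelof_space (subtopology X Y) \<and> (\<forall>U\<in>\<U>. U \<inter> Y \<noteq> {})))"

definition isolated_points_of :: "'a topology \<Rightarrow> 'a set" where
  "isolated_points_of X = {x \<in> topspace X. openin X {x}}"

text \<open>
  Cardinals are represented by cardinal orders, so the least infinite cardinal with a property
  \<open>P\<close> is determined up to \<open>=o\<close> only, provided \<open>P\<close> is invariant under \<open>=o\<close>; as for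
  the library's \<^const>\<open>cardSuc\<close>, a representative is chosen.
\<close>

definition least_infinite_cardinal :: "('b rel \<Rightarrow> bool) \<Rightarrow> 'b rel" where
  "least_infinite_cardinal P =
     (SOME r. Cinfinite r \<and> P r \<and> (\<forall>r'. Cinfinite r' \<and> P r' \<longrightarrow> r \<le>o r'))"

definition closed_pseudocharacter_le :: "'a topology \<Rightarrow> 'b rel \<Rightarrow> bool" where
  "closed_pseudocharacter_le X \<kappa> \<longleftrightarrow>
     (\<forall>x\<in>topspace X. \<exists>\<U>. (\<forall>U\<in>\<U>. openin X U \<and> x \<in> U) \<and> |\<U>| \<le>o \<kappa> \<and>
        (\<Inter>U\<in>\<U>. X closure_of U) = {x})"

definition tightness_le :: "'a topology \<Rightarrow> 'b rel \<Rightarrow> bool" where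
  "tightness_le X \<kappa> \<longleftrightarrow>
     (\<forall>A x. A \<subseteq> topspace X \<and> x \<in> X closure_of A \<longrightarrow>
        (\<exists>B. B \<subseteq> A \<and> |B| \<le>o \<kappa> \<and> x \<in> X closure_of B))"

text \<open>
  The tightness, and for Hausdorff spaces also the closed pseudocharacter, is at most
  \<open>|X| + \<aleph>\<^sub>0\<close>, so cardinal orders on \<open>'a + nat\<close> suffice: the lemmas below show that
  the chosen cardinals have the defining property and are least among the infinite cardinals
  with that property over every type.
\<close>

definition closed_pseudocharacter :: "'a topology \<Rightarrow> ('a + nat) rel" where
  "closed_pseudocharacter X = least_infinite_cardinal (closed_pseudocharacter_le X)"

definition tightness :: "'a topology \<Rightarrow> ('a + nat) rel" where
  "tightness X = least_infinite_cardinal (tightness_le X)"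

lemma least_infinite_cardinal:
  assumes "Cinfinite r" "P r"
  shows "Cinfinite (least_infinite_cardinal P)" (is ?A)
    and "P (least_infinite_cardinal P)" (is ?B)
    and "\<And>r'. Cinfinite r' \<Longrightarrow> P r' \<Longrightarrow> least_infinite_cardinal P \<le>o r'"
proof -
  let ?R = "{r. Cinfinite r \<and> P r}"
  have "?R \<noteq> {}" "\<forall>r\<in>?R. Card_order r"
    using assms by auto
  then obtain r0 where "r0 \<in> ?R" "\<forall>r'\<in>?R. r0 \<le>o r'"
    using exists_minim_Card_order[of ?R] by blast
  then have "\<exists>r. Cinfinite r \<and> P r \<and> (\<forall>r'. Cinfinite r' \<and> P r' \<longrightarrow> r \<le>o r')"
    by blast
  from someI_ex[OF this] show ?A ?B
    "\<And>r'. Cinfinite r' \<Longrightarrow> P r' \<Longrightarrow> least_infinite_cardinal P \<le>o r'"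
    unfolding least_infinite_cardinal_def by blast+
qed

lemma ordLeq_universe_cases:
  fixes r :: "'c rel"
  assumes "Cinfinite r"
  obtains "|UNIV :: 'b set| \<le>o r" | r' :: "'b rel" where "Cinfinite r'" "r' =o r"
proof (cases "|UNIV :: 'b set| \<le>o r")
  case True
  then show ?thesis using that by blast
next
  case False
  have field: "|Field r| =o r"
    using assms by (intro card_of_Field_ordIso) simp
  have "Well_order r"
    using assms by (intro card_order_on_well_order_on) simp
  with False have "r \<le>o |UNIV :: 'b set|"
    using ordLeq_total card_of_Well_order by blast
  then have "|Field r| \<le>o |UNIV :: 'b set|"
    using field ordIso_ordLeq_trans by blast
  then obtain A :: "'b set" where "|Field r| =o |A|"
    unfolding internalize_card_of_ordLeq2[of "Field r"] by auto
  with field have A: "r =o |A|"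
    using ordIso_symmetric ordIso_transitive by blast
  have "|A| =o r" using A by (rule ordIso_symmetric)
  moreover have "Cinfinite |A|"
    using assms A cinfinite_mono[of r "|A|"] by (simp add: ordIso_iff_ordLeq card_of_Card_order)
  ultimately show ?thesis using that by blast
qed

lemma Cinfinite_universe: "Cinfinite |UNIV :: ('a + nat) set|"
  by (intro conjI card_of_Card_order) (simp add: cinfinite_def Field_card_of)

lemma closed_pseudocharacter_le_mono:
  "closed_pseudocharacter_le X r \<Longrightarrow> r \<le>o r' \<Longrightarrow> closed_pseudocharacter_le X r'"
  unfolding closed_pseudocharacter_le_def by (meson ordLeq_transitive)

lemma tightness_le_mono:
  "tightness_le X r \<Longrightarrow> r \<le>o r' \<Longrightarrow> tightness_le X r'"
  unfolding tightness_le_def by (meson ordLeq_transitive)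

lemma tightness_le_universe: "tightness_le (X :: 'a topology) |UNIV :: ('a + nat) set|"
  unfolding tightness_le_def
proof safe
  fix A x assume "x \<in> X closure_of A"
  moreover have "|A| \<le>o |UNIV :: ('a + nat) set|"
    by (rule card_of_ordLeqI[of Inl]) auto
  ultimately show "\<exists>B\<subseteq>A. |B| \<le>o |UNIV :: ('a + nat) set| \<and> x \<in> X closure_of B"
    by blast
qed

lemma closed_pseudocharacter_le_universe:
  assumes "Hausdorff_space (X :: 'a topology)"
  shows "closed_pseudocharacter_le X |UNIV :: ('a + nat) set|"
  unfolding closed_pseudocharacter_le_def
proof
  fix x assume x: "x \<in> topspace X"
  have "\<exists>U. openin X U \<and> x \<in> U \<and> y \<notin> X closure_of U" if "y \<in> topspace X - {x}" for y
  proof -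
    from that x assms obtain U V where
      "openin X U" "openin X V" "x \<in> U" "y \<in> V" "disjnt U V"
      unfolding Hausdorff_space_def by blast
    then show ?thesis
      by (auto simp: in_closure_of disjnt_iff)
  qed
  then have "\<forall>y\<in>topspace X - {x}. \<exists>U. openin X U \<and> x \<in> U \<and> y \<notin> X closure_of U"
    by (intro ballI)
  from bchoice[OF this] obtain f where f: "\<forall>y\<in>topspace X - {x}.
      openin X (f y) \<and> x \<in> f y \<and> y \<notin> X closure_of f y" ..
  let ?U = "insert (topspace X) (f ` (topspace X - {x}))"
  have opn: "\<forall>U\<in>?U. openin X U \<and> x \<in> U"
    using f x by simp
  have cl: "x \<in> X closure_of U" if "U \<in> ?U" for U
  proof -
    from opn that have "openin X U" "x \<in> U" by (blast dest: bspec)+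
    then show ?thesis
      using closure_of_subset[of U X] openin_subset[of X U] by (simp add: subset_iff)
  qed
  have "y = x" if "y \<in> (\<Inter>U\<in>?U. X closure_of U)" for y
  proof (rule ccontr)
    assume "y \<noteq> x"
    with that have y: "y \<in> topspace X - {x}" by simp
    with that have "y \<in> X closure_of f y" by simp
    with bspec[OF f y] show False by simp
  qed
  then have "(\<Inter>U\<in>?U. X closure_of U) \<subseteq> {x}"
    unfolding subset_iff singleton_iff by iprover
  moreover have "x \<in> (\<Inter>U\<in>?U. X closure_of U)"
    using cl by (rule INT_I)
  ultimately have eq: "(\<Inter>U\<in>?U. X closure_of U) = {x}"
    by (simp only: set_eq_subset insert_subset empty_subsetI simp_thms)
  have "?U \<subseteq> (\<lambda>z. case z of Inl y \<Rightarrow> f y | Inr _ \<Rightarrow> topspace X) ` (UNIV :: ('a + nat) set)"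
  proof
    fix U assume "U \<in> ?U"
    then consider "U = topspace X" | y where "U = f y" by blast
    then show "U \<in> (\<lambda>z. case z of Inl y \<Rightarrow> f y | Inr _ \<Rightarrow> topspace X) ` (UNIV :: ('a + nat) set)"
    proof cases
      case 1
      then show ?thesis by (intro image_eqI[where x = "Inr 0"]) simp_all
    next
      case (2 y)
      then show ?thesis by (intro image_eqI[where x = "Inl y"]) simp_all
    qed
  qed
  then have "|?U| \<le>o |UNIV :: ('a + nat) set|"
    by (rule surj_imp_ordLeq)
  from opn this eq show "\<exists>\<U>. (\<forall>U\<in>\<U>. openin X U \<and> x \<in> U) \<and> |\<U>| \<le>o |UNIV :: ('a + nat) set| \<and>
      (\<Inter>U\<in>\<U>. X closure_of U) = {x}"
    by (intro exI[where x = ?U] conjI)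
qed

lemma closed_pseudocharacter:
  assumes "Hausdorff_space X"
  shows "Cinfinite (closed_pseudocharacter X)"
    and "closed_pseudocharacter_le X (closed_pseudocharacter X)"
  unfolding closed_pseudocharacter_def
  using least_infinite_cardinal[of _ "closed_pseudocharacter_le X", OF Cinfinite_universe
      closed_pseudocharacter_le_universe[OF assms]] by blast+

lemma closed_pseudocharacter_least:
  fixes X :: "'a topology" and r :: "'c rel"
  assumes "Hausdorff_space X" "Cinfinite r" "closed_pseudocharacter_le X r"
  shows "closed_pseudocharacter X \<le>o r"
proof -
  note least = least_infinite_cardinal(3)[of _ "closed_pseudocharacter_le X",
      OF Cinfinite_universe closed_pseudocharacter_le_universe[OF assms(1)],
      folded closed_pseudocharacter_def]
  from assms(2) show ?thesis
  proof (cases rule: ordLeq_universe_cases[where 'b = "'a + nat"])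
    case 1
    then show ?thesis
      using least[OF Cinfinite_universe closed_pseudocharacter_le_universe[OF assms(1)]]
        ordLeq_transitive by blast
  next
    case (2 r')
    then have "r \<le>o r'" "r' \<le>o r"
      by (auto simp: ordIso_iff_ordLeq)
    with 2(1) show ?thesis
      using least closed_pseudocharacter_le_mono[OF assms(3)] ordLeq_transitive by blast
  qed
qed

lemma tightness:
  shows "Cinfinite (tightness X)" and "tightness_le X (tightness X)"
  unfolding tightness_def
  using least_infinite_cardinal[of _ "tightness_le X", OF Cinfinite_universe
      tightness_le_universe] by blast+

lemma tightness_least:
  fixes X :: "'a topology" and r :: "'c rel"
  assumes "Cinfinite r" "tightness_le X r"
  shows "tightness X \<le>o r"
proof -
  note least = least_infinite_cardinal(3)[of _ "tightness_le X",
      OF Cinfinite_universe tightness_le_universe, folded tightness_def]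
  from assms(1) show ?thesis
  proof (cases rule: ordLeq_universe_cases[where 'b = "'a + nat"])
    case 1
    then show ?thesis
      using least[OF Cinfinite_universe tightness_le_universe] ordLeq_transitive by blast
  next
    case (2 r')
    then have "r \<le>o r'" "r' \<le>o r"
      by (auto simp: ordIso_iff_ordLeq)
    with 2(1) show ?thesis
      using least tightness_le_mono[OF assms(2)] ordLeq_transitive by blast
  qed
qed

end

theory Submission
  imports Defs "HOL-Library.Countable_Set_Type"
begin

text \<open>
  Applying strong cellular-Lindelofness to the family of singletons of isolated points gives a
  closed Lindelof subspace that contains a dense set, so \<open>X\<close> itself is Lindelof. It remains to
  run the Arhangelskii--Sapirovskii closing-off argument: with \<open>\<kappa> = \<psi>\<^sub>c(X) \<cdot> t(X)\<close>, choose a set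
  \<open>F\<close> of at most \<open>2\<^sup>\<kappa>\<close> points that contains the closure of each of its subsets of size at most
  \<open>\<kappa>\<close>, and that meets the complement of the union of every countable family of chosen
  neighbourhoods of points of \<open>F\<close> that does not cover \<open>X\<close>. By tightness \<open>F\<close> is closed, hence
  Lindelof; a point outside \<open>F\<close> would then give a countable family of neighbourhoods
  that covers \<open>F\<close> but not \<open>X\<close>, a contradiction.
\<close>

section \<open>Cardinal bounds by \<open>ctwo ^c r\<close>\<close>

lemma Cinfinite_ctwo_cexp: "Cinfinite r \<Longrightarrow> Cinfinite (ctwo ^c r)"
  by (rule Cinfinite_cexp) (simp_all add: ordLeq_refl ctwo_def card_of_Card_order)

lemma ordLeq_ctwo_cexp:
  assumes "|A| \<le>o r" "Cinfinite r"
  shows "|A| \<le>o ctwo ^c r"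
  using assms ordLess_ctwo_cexp[of r] ordLess_imp_ordLeq ordLeq_transitive by blast

lemma countable_imp_ordLeq:
  assumes "countable A" "Cinfinite r"
  shows "|A| \<le>o r"
  using assms countable_card_le_natLeq natLeq_ordLeq_cinfinite ordLeq_transitive by blast

text \<open>A nonempty subset of size at most \<open>r\<close> is the image of a function from
  \<open>Field r\<close> to \<open>A\<close>, and there are at most
  \<open>(ctwo ^c r) ^c r =o ctwo ^c r\<close> such functions.\<close>

lemma card_of_small_subsets:
  fixes r :: "'b rel" and A :: "'a set"
  assumes r: "Cinfinite r" and A: "|A| \<le>o ctwo ^c r"
  shows "|{B. B \<subseteq> A \<and> |B| \<le>o r}| \<le>o ctwo ^c r"
proof -
  let ?S = "{B. B \<subseteq> A \<and> |B| \<le>o r}"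
  have ne: "Field r \<noteq> {}"
    using r unfolding cinfinite_def by auto
  \<comment> \<open>The empty set is not an image of the nonempty \<open>Field r\<close>, so it is
    set aside and added back at the end.\<close>
  have sub: "?S - {{}} \<subseteq> (\<lambda>f. f ` Field r) ` Func (Field r) A"
  proof
    fix B assume "B \<in> ?S - {{}}"
    then have B: "B \<subseteq> A" "|B| \<le>o r" "B \<noteq> {}" by auto
    have "|B| \<le>o |Field r|"
      using r by (intro ordLeq_ordIso_trans[OF B(2)] ordIso_symmetric[OF card_of_Field_ordIso]) simp
    then obtain g where g: "g ` Field r = B"
      using iffD2[OF card_of_ordLeq2[OF B(3)]] by metis
    define f where "f = (\<lambda>x. if x \<in> Field r then g x else undefined)"
    have "f \<in> Func (Field r) A" "f ` Field r = B"
      using g B(1) by (auto simp: f_def Func_def)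
    then show "B \<in> (\<lambda>f. f ` Field r) ` Func (Field r) A" by blast
  qed
  have inf: "Cinfinite (ctwo ^c r)" by (rule Cinfinite_ctwo_cexp[OF r])
  have "|Func (Field r) A| =o |A| ^c r"
    unfolding cexp_def Field_card_of by (rule ordIso_refl[OF card_of_Card_order])
  also have "|A| ^c r \<le>o (ctwo ^c r) ^c r"
    using A r by (intro cexp_mono1) auto
  also have "(ctwo ^c r) ^c r =o ctwo ^c r"
    using r by (intro cexp_cprod_ordLeq Cinfinite_Cnotzero ordLeq_refl)
      (auto simp: ctwo_def card_of_Card_order)
  finally have func: "|Func (Field r) A| \<le>o ctwo ^c r" .
  have "|?S - {{}}| \<le>o ctwo ^c r"
    using ordLeq_transitive[OF ordLeq_transitive[OF card_of_mono1[OF sub] card_of_image] func] .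
  moreover have "|{{}} :: 'a set set| \<le>o ctwo ^c r"
    by (intro countable_imp_ordLeq inf) simp
  ultimately have "|{{}} \<union> (?S - {{}})| \<le>o ctwo ^c r"
    using inf unfolding cinfinite_def by (intro card_of_Un_ordLeq_infinite_Field) auto
  then show ?thesis
    by (rule ordLeq_transitive[OF card_of_mono1, rotated]) blast
qed

lemma card_of_UN_le_ctwo_cexp:
  assumes "Cinfinite r" "|I| \<le>o ctwo ^c r" "\<And>i. i \<in> I \<Longrightarrow> |A i| \<le>o ctwo ^c r"
  shows "|\<Union>i\<in>I. A i| \<le>o ctwo ^c r"
  using assms Cinfinite_ctwo_cexp[OF assms(1)] unfolding cinfinite_def
  by (intro card_of_UNION_ordLeq_infinite_Field) auto

section \<open>Closing off under an operation on small sets\<close>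

text \<open>
  The points constructed by stage \<open>i\<close> of the transfinite iteration of \<open>G\<close> on subsets of size
  at most \<open>r\<close>; defining the stages inductively avoids an explicit well-founded recursion.
\<close>

inductive closing_stage :: "'b rel \<Rightarrow> 'i rel \<Rightarrow> ('a set \<Rightarrow> 'a set) \<Rightarrow> 'i \<Rightarrow> 'a \<Rightarrow> bool"
  for r :: "'b rel" and s :: "'i rel" and G :: "'a set \<Rightarrow> 'a set" where
  closing_stageI: "(\<And>b. b \<in> B \<Longrightarrow> \<exists>j \<in> underS s i. closing_stage r s G j b) \<Longrightarrow> |B| \<le>o r \<Longrightarrow> x \<in> G B
    \<Longrightarrow> closing_stage r s G i x"

text \<open>Take the union of the stages along the successor cardinal of \<open>r\<close>. Each
  stage has at most \<open>r\<close> predecessors, so induction bounds it by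
  \<open>ctwo ^c r\<close>, and the successor cardinal is itself at most
  \<open>ctwo ^c r\<close>.\<close>

lemma exists_closed_under_small_subsets:
  fixes r :: "'b rel" and G :: "'a set \<Rightarrow> 'a set"
  assumes r: "Cinfinite r" and G: "\<And>B. |B| \<le>o r \<Longrightarrow> |G B| \<le>o ctwo ^c r"
  obtains F where "|F| \<le>o ctwo ^c r" "\<And>B. B \<subseteq> F \<Longrightarrow> |B| \<le>o r \<Longrightarrow> G B \<subseteq> F"
proof -
  define s where "s = cardSuc r"
  define S where "S i = {x. closing_stage r s G i x}" for i
  have s: "Cinfinite s" unfolding s_def by (rule Cinfinite_cardSuc[OF r])
  then have wo: "Well_order s" by (simp add: card_order_on_def)
  then have "trans s" "antisym s"
    by (auto simp: order_on_defs)
  then have mono_under: "underS s i \<subseteq> underS s j" if "(i, j) \<in> s" for i j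
    using that by (rule underS_incr)
  have "S i \<subseteq> S j" if "(i, j) \<in> s" for i j
  proof
    fix x assume "x \<in> S i"
    then have "closing_stage r s G i x" by (simp add: S_def)
    then have "closing_stage r s G j x"
    proof cases
      case (closing_stageI B)
      then show ?thesis
        using mono_under[OF that] by (intro closing_stage.intros[of B]) (meson subsetD)
    qed
    then show "x \<in> S j" by (simp add: S_def)
  qed
  then have chain: "relChain s S" by (simp add: relChain_def)
  have stage_le: "i \<in> Field s \<longrightarrow> |S i| \<le>o ctwo ^c r" for i
  proof (rule wo_rel.well_order_induct[of s "\<lambda>i. i \<in> Field s \<longrightarrow> |S i| \<le>o ctwo ^c r"])
    show "wo_rel s" using wo by (simp add: wo_rel_def)
    fix i assume IH: "\<forall>j. j \<noteq> i \<and> (j, i) \<in> s \<longrightarrow> j \<in> Field s \<longrightarrow> |S j| \<le>o ctwo ^c r"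
    show "i \<in> Field s \<longrightarrow> |S i| \<le>o ctwo ^c r"
    proof
      assume "i \<in> Field s"
      then have "|underS s i| <o cardSuc r"
        using s card_of_underS by (auto simp: s_def)
      then have "|underS s i| \<le>o r"
        using r cardSuc_ordLeq_ordLess card_of_Card_order by blast
      then have "|\<Union>j\<in>underS s i. S j| \<le>o ctwo ^c r" (is "|?U| \<le>o _")
        using IH by (intro card_of_UN_le_ctwo_cexp[OF r ordLeq_ctwo_cexp[OF _ r]])
          (auto simp: underS_def intro: FieldI1)
      then have "|\<Union>B\<in>{B. B \<subseteq> ?U \<and> |B| \<le>o r}. G B| \<le>o ctwo ^c r"
        by (intro card_of_UN_le_ctwo_cexp[OF r card_of_small_subsets[OF r]])
          (auto intro: G)
      moreover have "S i \<subseteq> (\<Union>B\<in>{B. B \<subseteq> ?U \<and> |B| \<le>o r}. G B)"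
        by (auto simp: S_def elim!: closing_stage.cases) blast
      ultimately show "|S i| \<le>o ctwo ^c r"
        using card_of_mono1 ordLeq_transitive by blast
    qed
  qed
  show ?thesis
  proof
    have "s \<le>o ctwo ^c r"
      unfolding s_def using r ordLess_ctwo_cexp Card_order_cexp cardSuc_least by blast
    then have "|Field s| \<le>o ctwo ^c r"
      using s card_of_Field_ordIso ordIso_ordLeq_trans by blast
    then show "|\<Union>i\<in>Field s. S i| \<le>o ctwo ^c r"
      using stage_le by (intro card_of_UN_le_ctwo_cexp r) auto
    fix B assume "B \<subseteq> (\<Union>i\<in>Field s. S i)" and Br: "|B| \<le>o r"
    \<comment> \<open>The successor cardinal is regular, so \<open>B\<close>, having size at most
      \<open>r\<close>, already lies in a single stage of the increasing chain.\<close>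
    then obtain i where i: "i \<in> Field s" "B \<subseteq> S i"
      using cardSuc_UNION_Cinfinite[OF r, of S B] chain unfolding s_def by blast
    \<comment> \<open>A stage draws only on strictly earlier ones, so \<open>G B\<close> appears at
      an index beyond \<open>i\<close>.\<close>
    obtain j where j: "j \<in> Field s" "i \<noteq> j" "(i, j) \<in> s"
      using Cinfinite_limit[OF i(1) s] by blast
    then have "i \<in> underS s j" by (simp add: underS_def)
    then have "\<exists>k\<in>underS s j. closing_stage r s G k b" if "b \<in> B" for b
      using i(2) that by (auto simp: S_def)
    then have "G B \<subseteq> S j"
      unfolding S_def using Br by (auto intro: closing_stageI[of B])
    with j(1) show "G B \<subseteq> (\<Union>i\<in>Field s. S i)" by blast
  qed
qed

section \<open>Cardinality of closures and of Lindelof spaces\<close>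

text \<open>Each point of the closure is coded by a family of at most \<open>r\<close> subsets of
  \<open>A\<close>, each of size at most \<open>r\<close>, whose closures meet in that point alone.
  Counting small subsets twice, first of \<open>A\<close> and then of \<open>?S\<close>, bounds the
  number of codes.\<close>

lemma card_of_closure_of_le:
  fixes X :: "'a topology" and r :: "'b rel"
  assumes r: "Cinfinite r" and psi: "closed_pseudocharacter_le X r" and t: "tightness_le X r"
    and A: "A \<subseteq> topspace X" "|A| \<le>o ctwo ^c r"
  shows "|X closure_of A| \<le>o ctwo ^c r"
proof -
  let ?S = "{B. B \<subseteq> A \<and> |B| \<le>o r}"
  have "\<forall>x\<in>X closure_of A. \<exists>\<C>. \<C> \<subseteq> ?S \<and> |\<C>| \<le>o r \<and> (\<Inter>C\<in>\<C>. X closure_of C) = {x}"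
  proof
    fix x assume x: "x \<in> X closure_of A"
    have "x \<in> topspace X" using x by (simp add: in_closure_of)
    then obtain \<U> where U: "\<And>U. U \<in> \<U> \<Longrightarrow> openin X U \<and> x \<in> U" "|\<U>| \<le>o r"
      "(\<Inter>U\<in>\<U>. X closure_of U) = {x}"
      using bspec[OF psi[unfolded closed_pseudocharacter_le_def]] by metis
    \<comment> \<open>Tightness is applied to \<open>U \<inter> A\<close>, not to \<open>A\<close>,
      so that the closure of \<open>B\<close> stays inside the closure of \<open>U\<close>.\<close>
    have "\<exists>B. B \<subseteq> U \<inter> A \<and> |B| \<le>o r \<and> x \<in> X closure_of B" if "U \<in> \<U>" for U
    proof -
      have "x \<in> X closure_of (U \<inter> A)"
        using x U(1)[OF that] openin_Int unfolding in_closure_of by (metis Int_iff)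
      then show ?thesis
        using t A(1) unfolding tightness_le_def by (metis le_infI2)
    qed
    then obtain f where f: "\<And>U. U \<in> \<U> \<Longrightarrow> f U \<subseteq> U \<inter> A \<and> |f U| \<le>o r \<and> x \<in> X closure_of f U"
      by metis
    have "(\<Inter>C\<in>f ` \<U>. X closure_of C) \<subseteq> {x}"
      unfolding U(3)[symmetric]
    proof (rule INT_greatest)
      fix U assume U: "U \<in> \<U>"
      then have "X closure_of f U \<subseteq> X closure_of U"
        using f by (intro closure_of_mono) blast
      with U show "(\<Inter>C\<in>f ` \<U>. X closure_of C) \<subseteq> X closure_of U" by blast
    qed
    moreover have "{x} \<subseteq> (\<Inter>C\<in>f ` \<U>. X closure_of C)" using f by simp
    ultimately have "(\<Inter>C\<in>f ` \<U>. X closure_of C) = {x}" by (rule equalityI)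
    moreover have "|f ` \<U>| \<le>o r"
      using U(2) card_of_image ordLeq_transitive by blast
    moreover have "f ` \<U> \<subseteq> ?S" using f by blast
    ultimately show "\<exists>\<C>. \<C> \<subseteq> ?S \<and> |\<C>| \<le>o r \<and> (\<Inter>C\<in>\<C>. X closure_of C) = {x}"
      by (intro exI conjI)
  qed
  from bchoice[OF this] obtain \<C> where C: "\<forall>x\<in>X closure_of A.
      \<C> x \<subseteq> ?S \<and> |\<C> x| \<le>o r \<and> (\<Inter>C\<in>\<C> x. X closure_of C) = {x}" ..
  have "inj_on \<C> (X closure_of A)"
  proof (rule inj_onI)
    fix x y assume "x \<in> X closure_of A" "y \<in> X closure_of A" "\<C> x = \<C> y"
    then have "{x} = {y}" using C by metis
    then show "x = y" by simp
  qed
  moreover have "\<C> ` (X closure_of A) \<subseteq> {\<D>. \<D> \<subseteq> ?S \<and> |\<D>| \<le>o r}"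
    using C by blast
  ultimately have "|X closure_of A| \<le>o |{\<D>. \<D> \<subseteq> ?S \<and> |\<D>| \<le>o r}|"
    by (intro iffD1[OF card_of_ordLeq] exI conjI)
  also have "|{\<D>. \<D> \<subseteq> ?S \<and> |\<D>| \<le>o r}| \<le>o ctwo ^c r"
    by (intro card_of_small_subsets r A)
  finally show ?thesis .
qed

lemma Lindelof_space_card_le:
  fixes X :: "'a topology" and r :: "'b rel"
  assumes L: "Lindelof_space X" and r: "Cinfinite r"
    and psi: "closed_pseudocharacter_le X r" and t: "tightness_le X r"
  shows "|topspace X| \<le>o ctwo ^c r"
proof -
  obtain \<U> where U: "\<And>x. x \<in> topspace X \<Longrightarrow> (\<forall>U\<in>\<U> x. openin X U \<and> x \<in> U) \<and> |\<U> x| \<le>o r \<and>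
      (\<Inter>U\<in>\<U> x. X closure_of U) = {x}"
    using psi unfolding closed_pseudocharacter_le_def by metis
  define p where "p \<V> = (SOME y. y \<in> topspace X - \<Union>\<V>)" for \<V>
  have p: "p \<V> \<in> topspace X - \<Union>\<V>" if "\<not> topspace X \<subseteq> \<Union>\<V>" for \<V>
    unfolding p_def by (rule someI_ex) (use that in blast)
  define N where "N B = \<Union>(\<U> ` (topspace X \<inter> B))" for B
  \<comment> \<open>The closure part will make \<open>F\<close> closed; the \<open>p\<close> part
    puts into \<open>F\<close> a witness against each small family that does not cover. For families
    that do cover, \<open>p\<close> is arbitrary and may leave the space, hence the later
    intersection of \<open>F\<close> with \<open>topspace X\<close>.\<close>
  define G where "G B = X closure_of B \<union> p ` {\<V>. \<V> \<subseteq> N B \<and> |\<V>| \<le>o r}" for B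
  have "|G B| \<le>o ctwo ^c r" if B: "|B| \<le>o r" for B
  proof -
    have B': "|topspace X \<inter> B| \<le>o r"
      using B card_of_mono1[of "topspace X \<inter> B" B] ordLeq_transitive by blast
    have "|X closure_of (topspace X \<inter> B)| \<le>o ctwo ^c r"
      by (intro card_of_closure_of_le r psi t ordLeq_ctwo_cexp B') auto
    moreover have "|N B| \<le>o ctwo ^c r"
      unfolding N_def using U by (intro card_of_UN_le_ctwo_cexp r ordLeq_ctwo_cexp B') auto
    then have "|p ` {\<V>. \<V> \<subseteq> N B \<and> |\<V>| \<le>o r}| \<le>o ctwo ^c r"
      using card_of_small_subsets[OF r] card_of_image ordLeq_transitive by blast
    ultimately show ?thesis
      using Cinfinite_ctwo_cexp[OF r] unfolding G_def cinfinite_def closure_of_restrict[of X B]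
      by (intro card_of_Un_ordLeq_infinite_Field) auto
  qed
  then obtain F where F: "|F| \<le>o ctwo ^c r" "\<And>B. B \<subseteq> F \<Longrightarrow> |B| \<le>o r \<Longrightarrow> G B \<subseteq> F"
    using exists_closed_under_small_subsets[OF r, of G] by blast
  let ?F = "topspace X \<inter> F"
  have "X closure_of ?F \<subseteq> ?F"
  proof
    fix x assume x: "x \<in> X closure_of ?F"
    then obtain B where B: "B \<subseteq> ?F" "|B| \<le>o r" "x \<in> X closure_of B"
      using t unfolding tightness_le_def by (metis inf_le1)
    then have "x \<in> F" using F(2)[of B] by (auto simp: G_def)
    then show "x \<in> ?F" using x by (simp add: in_closure_of)
  qed
  then have "closedin X ?F"
    using closure_of_subset_eq[of ?F X] by blast
  then have LF: "Lindelof_space (subtopology X ?F)"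
    by (rule Lindelof_space_closedin_subtopology[OF L])
  have "topspace X \<subseteq> F"
  proof
    fix q assume q: "q \<in> topspace X"
    show "q \<in> F"
    proof (rule ccontr)
      assume qF: "q \<notin> F"
      \<comment> \<open>Since \<open>x\<close> differs from \<open>q\<close>, some neighbourhood in
        \<open>\<U> x\<close> has a closure missing \<open>q\<close>.\<close>
      have "\<exists>U. U \<in> \<U> x \<and> q \<notin> U" if x: "x \<in> ?F" for x
      proof -
        have "q \<notin> (\<Inter>U\<in>\<U> x. X closure_of U)" using U[of x] x qF by auto
        then obtain W where "W \<in> \<U> x" "q \<notin> X closure_of W" by blast
        moreover from this have "W \<subseteq> X closure_of W"
          using U[of x] x by (intro closure_of_subset openin_subset) auto
        ultimately show ?thesis by blast
      qed
      then obtain h where h: "\<And>x. x \<in> ?F \<Longrightarrow> h x \<in> \<U> x \<and> q \<notin> h x" by metis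
      have hU: "openin X (h x) \<and> x \<in> h x" if "x \<in> ?F" for x
        using h[OF that] U[of x] that by blast
      have op: "\<forall>U\<in>h ` ?F. openin X U" and cov: "?F \<subseteq> \<Union>(h ` ?F)"
        using hU by blast+
      then obtain \<V> where V: "countable \<V>" "\<V> \<subseteq> h ` ?F" "?F \<subseteq> \<Union>\<V>"
        using LF unfolding Lindelof_space_subtopology_subset[OF Int_lower1] by meson
      \<comment> \<open>The countable set \<open>B\<close> of centres ties \<open>\<V>\<close> to
        \<open>N B\<close>, so closure of \<open>F\<close> under \<open>G\<close> yields
        \<open>p \<V> \<in> F\<close>. As \<open>\<V>\<close> misses \<open>q\<close>, that point
        lies outside \<open>\<Union>\<V>\<close>, although \<open>\<V>\<close> covers
        \<open>?F\<close>.\<close>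
      obtain B where B: "countable B" "B \<subseteq> ?F" "\<V> = h ` B"
        using V countable_subset_image[of \<V> h ?F] by blast
      have "\<V> \<subseteq> N B" unfolding N_def using B h by blast
      moreover have "|\<V>| \<le>o r" "|B| \<le>o r"
        using V B r countable_imp_ordLeq by blast+
      ultimately have "p \<V> \<in> F"
        using F(2)[of B] B(2) by (auto simp: G_def)
      moreover have "q \<notin> \<Union>\<V>" using B h by blast
      then have "p \<V> \<in> topspace X - \<Union>\<V>" using q by (intro p) blast
      ultimately show False using V(3) by blast
    qed
  qed
  then show ?thesis using F(1) card_of_mono1 ordLeq_transitive by blast
qed

lemma strongly_cellular_Lindelof_imp_Lindelof_space:
  assumes "strongly_cellular_Lindelof_space X"
    and dense: "X closure_of isolated_points_of X = topspace X"
  shows "Lindelof_space X"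
proof -
  let ?\<U> = "(\<lambda>x. {x}) ` isolated_points_of X"
  have "(\<forall>U\<in>?\<U>. openin X U \<and> U \<noteq> {}) \<and> pairwise disjnt ?\<U>"
    by (auto simp: isolated_points_of_def pairwise_def)
  from assms(1)[unfolded strongly_cellular_Lindelof_space_def, rule_format, OF this]
  obtain Y where Y: "closedin X Y" "Lindelof_space (subtopology X Y)" "\<forall>U\<in>?\<U>. U \<inter> Y \<noteq> {}"
    by metis
  \<comment> \<open>Meeting a singleton means containing its point; a closed set containing a dense
    set is everything.\<close>
  then have "isolated_points_of X \<subseteq> Y" by auto
  then have "topspace X \<subseteq> Y"
    using closure_of_minimal[OF _ Y(1)] dense by blast
  with Y show ?thesis by (simp add: subtopology_superset)
qed

theorem theorem11:
  fixes X :: "'a topology"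
  assumes "Hausdorff_space X"
    and "strongly_cellular_Lindelof_space X"
    and "X closure_of isolated_points_of X = topspace X"
  shows "|topspace X| \<le>o ctwo ^c (closed_pseudocharacter X *c tightness X)"
proof (rule Lindelof_space_card_le)
  note psi = closed_pseudocharacter[OF assms(1)] and t = tightness[of X]
  show "Lindelof_space X"
    by (rule strongly_cellular_Lindelof_imp_Lindelof_space[OF assms(2,3)])
  show "Cinfinite (closed_pseudocharacter X *c tightness X)"
    by (rule Cinfinite_cprod2[OF Cinfinite_Cnotzero[OF psi(1)] t(1)])
  \<comment> \<open>The product dominates each factor because the other is nonzero, and both
    properties pass to larger cardinals.\<close>
  show "closed_pseudocharacter_le X (closed_pseudocharacter X *c tightness X)"
    unfolding cprod_def using psi(1) Cinfinite_Cnotzero[OF t(1)]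
    by (intro closed_pseudocharacter_le_mono[OF psi(2)] Card_order_Times1)
      (auto dest: czeroI)
  show "tightness_le X (closed_pseudocharacter X *c tightness X)"
    using t(1) by (intro tightness_le_mono[OF t(2)] ordLeq_cprod2
        Cinfinite_Cnotzero[OF psi(1)]) (rule conjunct2)
qed

end
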